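(* Let $\mathcal{X}$ be a Polish space, let $I:\mathcal{X}\to[0,\infty]$ be a rate function with $\inf_{x\in\mathcal{X}}I(x)=0$ which is continuous on its domain of finiteness $\{I<\infty\}$, and let $F:\mathcal{X}\to\mathbb{R}$ be continuous and bounded below. Fix an integer $K\ge 1$. Let $D\doteq\{(I(x),F(x)):x\in\mathcal{X},\ I(x)<\infty\}$, and for $\boldsymbol{\alpha}=(\alpha_1,\dots,\alpha_K)$ with $1=\alpha_1\ge\alpha_2\ge\cdots\ge\alpha_K\ge 0$ define $$V_F(\boldsymbol{\alpha})\doteq\inf\left\{2\sum_{j=1}^K\alpha_jI_j+2F-\min_{\sigma\in\Sigma_K}\sum_{j=1}^K\alpha_jI_{\sigma(j)}\ :\ (I_1,F)\in D,\ I_j\in[0,I_1]\text{ for } j=2,\dots,K\right\}$$ (inside the braces $F$ denotes the second coordinate of a point of $D$). Then for every such $\boldsymbol{\alpha}$, $$\inf_{\mathbf{x}\in\mathcal{X}^K}\left[2\sum_{j=1}^K\alpha_jI(x_j)+2F(x_1)-\min_{\sigma\in\Sigma_K}\left\{\sum_{j=1}^K\alpha_jI(x_{\sigma(j)})\right\}\right]=V_F(\boldsymbol{\alpha}).$$ Moreover, $$\sup_{\boldsymbol{\alpha}}V_F(\boldsymbol{\alpha})=\inf_{x\in\mathcal{X}}\left\{\left(2-(1/2)^{K-1}\right)I(x)+2F(x)\right\},$$ where the supremum is over all $\boldsymbol{\alpha}$ with $1=\alpha_1\ge\alpha_2\ge\cdots\ge\alpha_K\ge0$, and $\boldsymbol{\alpha}^*=(1,1/2,1/4,\dots,(1/2)^{K-1})$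 achieves the supremum.
   Context: A rate function on $\mathcal{X}$ is a map $I:\mathcal{X}\to[0,\infty]$ such that $\{x:I(x)\le M\}$ is compact for every $M\in[0,\infty)$. "Continuous on its domain of finiteness" means that the restriction of $I$ to $\{x:I(x)<\infty\}$ (with the subspace topology) is continuous. $\Sigma_K$ is the set of permutations of $\{1,\dots,K\}$. Convention: in the infimum over $\mathbf{x}=(x_1,\dots,x_K)\in\mathcal{X}^K$, the bracketed expression is taken to be $+\infty$ if $I(x_j)=\infty$ for some $j$. *)

theory Defs
  imports "HOL-Analysis.Analysis" "HOL-Combinatorics.Permutations"
begin

definition rate_function :: "('a::topological_space \<Rightarrow> ennreal) \<Rightarrow> bool" where
  "rate_function I \<longleftrightarrow> (\<forall>M<\<infinity>. compact {x. I x \<le> M})"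

text \<open>K-tuples are functions on the naturals of which only the values at 1, ..., K are used.\<close>

definition weights :: "nat \<Rightarrow> (nat \<Rightarrow> real) set" where
  "weights K = {\<alpha>. \<alpha> 1 = 1 \<and> (\<forall>j\<in>{1..<K}. \<alpha> (j + 1) \<le> \<alpha> j) \<and> 0 \<le> \<alpha> K}"

text \<open>The real expression under the infimum, at rate values J 1, ..., J K and second coordinate f.\<close>

definition bracket :: "nat \<Rightarrow> (nat \<Rightarrow> real) \<Rightarrow> (nat \<Rightarrow> real) \<Rightarrow> real \<Rightarrow> real" where
  "bracket K \<alpha> J f = 2 * (\<Sum>j=1..K. \<alpha> j * J j) + 2 * f
     - (MIN \<sigma>\<in>{\<sigma>. \<sigma> permutes {1..K}}. \<Sum>j=1..K. \<alpha> j * J (\<sigma> j))"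

text \<open>The same expression at points of the space; it is infinite by convention
  as soon as one of the rates is, even if the corresponding weight vanishes.\<close>

definition bracket_at ::
  "('a \<Rightarrow> ennreal) \<Rightarrow> ('a \<Rightarrow> real) \<Rightarrow> nat \<Rightarrow> (nat \<Rightarrow> real) \<Rightarrow> (nat \<Rightarrow> 'a) \<Rightarrow> ereal" where
  "bracket_at I F K \<alpha> x =
     (if \<exists>j\<in>{1..K}. I (x j) = \<infinity> then \<infinity>
      else ereal (bracket K \<alpha> (\<lambda>j. enn2real (I (x j))) (F (x 1))))"

definition D_set :: "('a \<Rightarrow> ennreal) \<Rightarrow> ('a \<Rightarrow> real) \<Rightarrow> (real \<times> real) set" where
  "D_set I F = {(enn2real (I x), F x) | x. I x < \<infinity>}"

definition V :: "('a \<Rightarrow> ennreal) \<Rightarrow> ('a \<Rightarrow> real) \<Rightarrow> nat \<Rightarrow> (nat \<Rightarrow> real) \<Rightarrow> ereal" where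
  "V I F K \<alpha> = Inf {ereal (bracket K \<alpha> J f) | J f.
     (J 1, f) \<in> D_set I F \<and> (\<forall>j\<in>{2..K}. J j \<in> {0..J 1})}"

end

theory Submission
  imports Defs
begin

text \<open>
  On the chamber where the remaining rates are increasing, the bracket is linear in them, so it
  is minimised when each of them is 0 or \<open>I\<^sub>1\<close>. If exactly \<open>I\<^sub>2, \<dots>, I\<^sub>l\<close> vanish, the value is
  \<open>(2 - \<alpha>\<^sub>l + \<alpha>\<^sub>l\<^sub>+\<^sub>1 + \<dots> + \<alpha>\<^sub>K) I\<^sub>1 + 2 F\<close>. These extremal configurations are realised
  in the space, even if it is disconnected, because the rate function attains the value 0. Hence
  both infima equal the infimum of \<open>m I + 2 F\<close>, where \<open>m\<close> is the least of these \<open>K\<close>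
  coefficients. A doubling recursion for the tail sums of \<open>\<alpha>\<close> gives \<open>m \<le> 2 - (1/2)^(K-1)\<close>, and
  the geometric weights make all \<open>K\<close> coefficients equal to this bound.
\<close>

text \<open>With \<open>s\<close> the sum of the weights beyond \<open>l\<close> and
  \<open>\<alpha> 1 = 1\<close>, this is \<open>2 * (1 + s) - (\<alpha> l + s)\<close>: twice the
  weighted sum of the extremal configuration minus its cheapest rearrangement, per unit of
  \<open>I\<^sub>1\<close>.\<close>

definition coef :: "nat \<Rightarrow> (nat \<Rightarrow> real) \<Rightarrow> nat \<Rightarrow> real" where
  "coef K \<alpha> l = 2 - \<alpha> l + (\<Sum>j=l+1..K. \<alpha> j)"

definition min_coef :: "nat \<Rightarrow> (nat \<Rightarrow> real) \<Rightarrow> real" where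
  "min_coef K \<alpha> = (MIN l\<in>{1..K}. coef K \<alpha> l)"

section \<open>Monotone weights and sorting\<close>

lemma weights_antimono:
  assumes "\<alpha> \<in> weights K" "1 \<le> i" "i \<le> j" "j \<le> K"
  shows "\<alpha> j \<le> \<alpha> i"
  using assms(3,4)
proof (induction j rule: dec_induct)
  case (step n)
  then have "\<alpha> (n + 1) \<le> \<alpha> n" using assms(1,2) by (auto simp: weights_def)
  with step show ?case by simp
qed simp

lemma weights_nonneg:
  assumes "\<alpha> \<in> weights K" "1 \<le> i" "i \<le> K"
  shows "0 \<le> \<alpha> i"
  using weights_antimono[OF assms(1,2,3) order.refl] assms(1) by (simp add: weights_def)

text \<open>Any bijection from \<open>T - S\<close> to \<open>S - T\<close>, with \<open>T\<close>
  the block of indices beyond \<open>l\<close>, only moves indices downwards and so never decreases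
  a weight.\<close>

lemma sum_tail_le_sum_subset:
  fixes \<alpha> :: "nat \<Rightarrow> real"
  assumes anti: "\<And>i j. 1 \<le> i \<Longrightarrow> i \<le> j \<Longrightarrow> j \<le> K \<Longrightarrow> \<alpha> j \<le> \<alpha> i"
    and S: "S \<subseteq> {1..K}" and card: "card S = K - l"
  shows "(\<Sum>j=l+1..K. \<alpha> j) \<le> sum \<alpha> S"
proof -
  define T where "T = {l+1..K}"
  have fin: "finite S" "finite T" using S finite_subset by (auto simp: T_def)
  have "card (S - T) = card (T - S)"
    using card fin by (simp add: card_Diff_subset_Int Int_commute T_def)
  then obtain h where h: "bij_betw h (T - S) (S - T)"
    using fin finite_same_card_bij[of "T - S" "S - T"] by auto
  have "sum \<alpha> (T - S) \<le> (\<Sum>i\<in>T - S. \<alpha> (h i))"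
  proof (rule sum_mono)
    fix i assume i: "i \<in> T - S"
    then have "h i \<in> S - T" using h by (auto simp: bij_betw_def)
    then show "\<alpha> i \<le> \<alpha> (h i)" using i S by (intro anti) (auto simp: T_def)
  qed
  also have "\<dots> = sum \<alpha> (S - T)" by (rule sum.reindex_bij_betw[OF h])
  finally show ?thesis
    using sum.Int_Diff[OF fin(1), of \<alpha> T] sum.Int_Diff[OF fin(2), of \<alpha> S]
    by (simp add: Int_commute T_def)
qed

lemma exists_sorting_permutation:
  fixes J :: "nat \<Rightarrow> real"
  obtains \<sigma> where "\<sigma> permutes {1..K}"
    and "\<And>i j. 1 \<le> i \<Longrightarrow> i \<le> j \<Longrightarrow> j \<le> K \<Longrightarrow> J (\<sigma> i) \<le> J (\<sigma> j)"
proof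
  define xs where "xs = sort_key J [1..<K+1]"
  \<comment> \<open>List positions start at 0, whence \<open>i - 1\<close>; outside
    \<open>{1..K}\<close> a permutation of that set has to be the identity.\<close>
  define \<sigma> where "\<sigma> = (\<lambda>i. if i \<in> {1..K} then xs ! (i - 1) else i)"
  have xs: "set xs = {1..K}" "distinct xs" "length xs = K" "sorted (map J xs)"
    by (auto simp: xs_def)
  have "inj_on \<sigma> {1..K}"
  proof (rule inj_onI)
    fix i j assume "i \<in> {1..K}" "j \<in> {1..K}" "\<sigma> i = \<sigma> j"
    moreover from this have "i - 1 = j - 1"
      using xs nth_eq_iff_index_eq[of xs "i - 1" "j - 1"] by (auto simp: \<sigma>_def)
    ultimately show "i = j" by auto
  qed
  moreover have sub: "\<sigma> ` {1..K} \<subseteq> {1..K}"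
  proof
    fix y assume "y \<in> \<sigma> ` {1..K}"
    then obtain i where "i \<in> {1..K}" "y = xs ! (i - 1)" by (auto simp: \<sigma>_def)
    then have "y \<in> set xs" using xs(3) by auto
    then show "y \<in> {1..K}" using xs(1) by simp
  qed
  ultimately have "bij_betw \<sigma> {1..K} {1..K}"
    by (simp add: bij_betw_def endo_inj_surj)
  then show "\<sigma> permutes {1..K}" by (rule bij_imp_permutes) (auto simp: \<sigma>_def)
  fix i j assume "1 \<le> i" "i \<le> j" "j \<le> K"
  then show "J (\<sigma> i) \<le> J (\<sigma> j)"
    using sorted_nth_mono[OF xs(4), of "i - 1" "j - 1"] xs(3) by (auto simp: \<sigma>_def)
qed

section \<open>Lower bound for the bracket\<close>

text \<open>Abel summation: with \<open>T k\<close> the tail sum of \<open>w\<close> from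
  \<open>k\<close>, the right side is \<open>T 1 * u 1\<close> plus the terms
  \<open>T k * (u k - u (k - 1))\<close> for \<open>k \<ge> 2\<close>. Bounding \<open>T k\<close>
  below by \<open>m\<close> up to \<open>p\<close> and by 0 beyond makes the sum telescope to
  \<open>m * u p\<close>.\<close>

lemma weighted_sum_ge_by_tail_sums:
  fixes u w :: "nat \<Rightarrow> real"
  assumes mono: "\<And>i j. 1 \<le> i \<Longrightarrow> i \<le> j \<Longrightarrow> j \<le> K \<Longrightarrow> u i \<le> u j"
    and nonneg: "0 \<le> u 1" and p: "1 \<le> p" "p \<le> K"
    and tail_le: "\<And>k. 1 \<le> k \<Longrightarrow> k \<le> p \<Longrightarrow> m \<le> (\<Sum>i=k..K. w i)"
    and tail_gt: "\<And>k. p < k \<Longrightarrow> k \<le> K \<Longrightarrow> 0 \<le> (\<Sum>i=k..K. w i)"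
  shows "m * u p \<le> (\<Sum>i=1..K. w i * u i)"
proof -
  let ?T = "\<lambda>k. \<Sum>i=k..K. w i"
  \<comment> \<open>Abel summation stopped at \<open>k\<close>, by downward induction. Truncating at
    \<open>min k p\<close> removes the increments beyond \<open>p\<close>, so that one formula
    covers both ranges of \<open>k\<close>.\<close>
  have ineq: "m * (u p - u (min k p)) + ?T k * u k \<le> (\<Sum>i=k..K. w i * u i)"
    if "1 \<le> k" "k \<le> K" for k
    using that(2,1)
  proof (induction k rule: inc_induct)
    case base
    then show ?case using p by (simp add: min_absorb2)
  next
    case (step k)
    have inc: "0 \<le> u (Suc k) - u k" using mono[of k "Suc k"] step by simp
    have "m * (u (min (Suc k) p) - u (min k p)) \<le> ?T (Suc k) * (u (Suc k) - u k)"
    proof (cases "Suc k \<le> p")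
      case True
      then show ?thesis
        using mult_right_mono[OF tail_le[of "Suc k"] inc] step by (simp add: min_absorb1)
    next
      case False
      then show ?thesis
        using mult_nonneg_nonneg[OF tail_gt[of "Suc k"] inc] step by (simp add: min_absorb2)
    qed
    moreover have "?T k = w k + ?T (Suc k)"
      "(\<Sum>i=k..K. w i * u i) = w k * u k + (\<Sum>i=Suc k..K. w i * u i)"
      using step by (simp_all add: sum.atLeast_Suc_atMost)
    moreover have "m * (u p - u (min (Suc k) p)) + ?T (Suc k) * u (Suc k)
        \<le> (\<Sum>i=Suc k..K. w i * u i)"
      using step by simp
    ultimately show ?case by (simp add: algebra_simps)
  qed
  have "m * u 1 \<le> ?T 1 * u 1" using mult_right_mono[OF tail_le[of 1] nonneg] p by simp
  with ineq[of 1] p show ?thesis by (simp add: algebra_simps min_absorb1)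
qed

text \<open>The minimum over permutations is at most its value at a permutation sorting
  \<open>J\<close>. What remains is a linear form in increasing rates, and its tail sums meet the
  conditions of the Abel bound at the position \<open>p\<close> of the index 1. Rates above
  \<open>J 1\<close> are allowed, as they occur for K-tuples of points.\<close>

lemma bracket_ge_min_coef:
  assumes \<alpha>: "\<alpha> \<in> weights K" and J: "\<And>j. j \<in> {1..K} \<Longrightarrow> 0 \<le> J j" and K: "1 \<le> K"
  shows "min_coef K \<alpha> * J 1 + 2 * f \<le> bracket K \<alpha> J f"
proof -
  obtain \<sigma> where \<sigma>: "\<sigma> permutes {1..K}"
    and sorted: "\<And>i j. 1 \<le> i \<Longrightarrow> i \<le> j \<Longrightarrow> j \<le> K \<Longrightarrow> J (\<sigma> i) \<le> J (\<sigma> j)"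
    using exists_sorting_permutation[of K J] by blast
  have anti: "\<And>i j. 1 \<le> i \<Longrightarrow> i \<le> j \<Longrightarrow> j \<le> K \<Longrightarrow> \<alpha> j \<le> \<alpha> i"
    using weights_antimono[OF \<alpha>] by blast
  have one: "\<alpha> 1 = 1" using \<alpha> by (simp add: weights_def)
  have inj: "inj \<sigma>" using \<sigma> by (rule permutes_inj)
  obtain p where p: "p \<in> {1..K}" "\<sigma> p = 1"
    using permutes_image[OF \<sigma>] K by (metis atLeastAtMost_iff imageE order.refl)
  \<comment> \<open>\<open>w i\<close> is the coefficient of \<open>J (\<sigma> i)\<close> once the
    first sum of the bracket is reindexed by \<open>\<sigma>\<close>.\<close>
  define w where "w i = 2 * \<alpha> (\<sigma> i) - \<alpha> i" for i
  have tail: "(\<Sum>i=k..K. w i) = 2 * sum \<alpha> (\<sigma> ` {k..K}) - (\<Sum>i=k..K. \<alpha> i)" for k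
    using inj by (simp add: w_def sum_subtractf sum_distrib_left sum.reindex inj_on_subset)
  have image: "\<sigma> ` {k..K} \<subseteq> {1..K}" "card (\<sigma> ` {k..K}) = K + 1 - k" if "1 \<le> k" for k
  proof -
    have "{k..K} \<subseteq> {1..K}" using that by auto
    then show "\<sigma> ` {k..K} \<subseteq> {1..K}" using permutes_image[OF \<sigma>] by blast
    show "card (\<sigma> ` {k..K}) = K + 1 - k"
      using card_image[OF inj_on_subset[OF inj subset_UNIV], of "{k..K}"] by simp
  qed
  have "min_coef K \<alpha> * J (\<sigma> p) \<le> (\<Sum>i=1..K. w i * J (\<sigma> i))"
  proof (rule weighted_sum_ge_by_tail_sums)
    show "0 \<le> J (\<sigma> 1)" using J permutes_in_image[OF \<sigma>] K by simp
    show "1 \<le> p" "p \<le> K" using p by auto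
  next
    fix k assume k: "1 \<le> k" "k \<le> p"
    \<comment> \<open>Up to \<open>p\<close> the tail still contains the index 1. Splitting off its
      weight 1 leaves \<open>K - k\<close> indices, which turns the bound into
      \<open>coef K \<alpha> k\<close>.\<close>
    have mem: "1 \<in> \<sigma> ` {k..K}" using p k by (auto intro!: image_eqI[of _ _ p])
    have "(\<Sum>i=k+1..K. \<alpha> i) \<le> sum \<alpha> (\<sigma> ` {k..K} - {1})"
      by (rule sum_tail_le_sum_subset[OF anti]) (use image[OF k(1)] mem in auto)
    moreover have "sum \<alpha> (\<sigma> ` {k..K}) = 1 + sum \<alpha> (\<sigma> ` {k..K} - {1})"
      using mem one by (simp add: sum.remove)
    moreover have "(\<Sum>i=k..K. \<alpha> i) = \<alpha> k + (\<Sum>i=k+1..K. \<alpha> i)"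
      using k p by (simp add: sum.atLeast_Suc_atMost)
    moreover have "min_coef K \<alpha> \<le> coef K \<alpha> k"
      unfolding min_coef_def using k p by (intro Min_le) auto
    ultimately show "min_coef K \<alpha> \<le> (\<Sum>i=k..K. w i)"
      unfolding tail coef_def by simp
  next
    fix k assume k: "p < k" "k \<le> K"
    \<comment> \<open>Beyond \<open>p\<close> all \<open>K - (k - 1)\<close> indices are compared
      with the last block, so twice the sum over the image exceeds the subtracted tail by at least
      that tail.\<close>
    have "(\<Sum>i=(k-1)+1..K. \<alpha> i) \<le> sum \<alpha> (\<sigma> ` {k..K})"
      by (rule sum_tail_le_sum_subset[OF anti]) (use image[of k] k p in auto)
    moreover have "0 \<le> (\<Sum>i=k..K. \<alpha> i)"
      using weights_nonneg[OF \<alpha>] k p by (intro sum_nonneg) auto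
    ultimately show "0 \<le> (\<Sum>i=k..K. w i)" unfolding tail using k by simp
  qed (use sorted in auto)
  also have "(\<Sum>i=1..K. w i * J (\<sigma> i))
      = 2 * (\<Sum>i=1..K. \<alpha> (\<sigma> i) * J (\<sigma> i)) - (\<Sum>i=1..K. \<alpha> i * J (\<sigma> i))"
    by (simp add: w_def sum_subtractf sum_distrib_left algebra_simps)
  also have "(\<Sum>i=1..K. \<alpha> (\<sigma> i) * J (\<sigma> i)) = (\<Sum>i=1..K. \<alpha> i * J i)"
    using sum.permute[OF \<sigma>, of "\<lambda>i. \<alpha> i * J i"] by (simp add: comp_def)
  finally have "min_coef K \<alpha> * J 1
      \<le> 2 * (\<Sum>i=1..K. \<alpha> i * J i) - (\<Sum>i=1..K. \<alpha> i * J (\<sigma> i))"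
    using p by simp
  moreover have "(MIN \<sigma>\<in>{\<sigma>. \<sigma> permutes {1..K}}. \<Sum>j=1..K. \<alpha> j * J (\<sigma> j))
      \<le> (\<Sum>i=1..K. \<alpha> i * J (\<sigma> i))"
    using \<sigma> by (intro Min_le) (auto simp: finite_permutations)
  ultimately show ?thesis unfolding bracket_def by linarith
qed

section \<open>Upper bound at the extremal configurations\<close>

text \<open>Every rearrangement places the value \<open>a\<close> at \<open>K - l + 1\<close>
  positions, whose weights add up to at least those of the last block, which starts at
  \<open>l\<close>. This bounds the subtracted minimum from below.\<close>

lemma bracket_extremal_le:
  assumes \<alpha>: "\<alpha> \<in> weights K" and l: "l \<in> {1..K}" and a: "0 \<le> a"
    and J: "\<And>j. j \<in> {1..K} \<Longrightarrow> J j = (if j = 1 \<or> l < j then a else 0)"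
  shows "bracket K \<alpha> J f \<le> coef K \<alpha> l * a + 2 * f"
proof -
  define A where "A = insert 1 {l+1..K}"
  have A: "A \<subseteq> {1..K}" using l by (auto simp: A_def)
  have JA: "J j = (if j \<in> A then a else 0)" if "j \<in> {1..K}" for j
    using J[OF that] that by (auto simp: A_def)
  have one: "\<alpha> 1 = 1" using \<alpha> by (simp add: weights_def)
  have "(\<Sum>j=1..K. \<alpha> j * J j) = (\<Sum>j=1..K. if j \<in> A then \<alpha> j * a else 0)"
    by (intro sum.cong) (auto simp: JA)
  also have "\<dots> = (\<Sum>j\<in>A. \<alpha> j * a)"
    using A by (simp add: sum.If_cases Int_absorb1)
  also have "\<dots> = (1 + (\<Sum>j=l+1..K. \<alpha> j)) * a"
    using l one by (simp add: A_def distrib_right flip: sum_distrib_right)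
  finally have main: "(\<Sum>j=1..K. \<alpha> j * J j) = (1 + (\<Sum>j=l+1..K. \<alpha> j)) * a" .
  have "(\<alpha> l + (\<Sum>j=l+1..K. \<alpha> j)) * a
      \<le> (MIN \<sigma>\<in>{\<sigma>. \<sigma> permutes {1..K}}. \<Sum>j=1..K. \<alpha> j * J (\<sigma> j))"
  proof (intro Min.boundedI)
    show "finite ((\<lambda>\<sigma>. \<Sum>j=1..K. \<alpha> j * J (\<sigma> j)) ` {\<sigma>. \<sigma> permutes {1..K}})"
      by (simp add: finite_permutations)
    show "(\<lambda>\<sigma>. \<Sum>j=1..K. \<alpha> j * J (\<sigma> j)) ` {\<sigma>. \<sigma> permutes {1..K}} \<noteq> {}"
      using permutes_id by blast
  next
    fix s assume "s \<in> (\<lambda>\<sigma>. \<Sum>j=1..K. \<alpha> j * J (\<sigma> j)) ` {\<sigma>. \<sigma> permutes {1..K}}"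
    then obtain \<sigma> where \<sigma>: "\<sigma> permutes {1..K}" and s: "s = (\<Sum>j=1..K. \<alpha> j * J (\<sigma> j))" by auto
    \<comment> \<open>The positions that receive the rate \<open>a\<close> under
      \<open>\<sigma>\<close>.\<close>
    define B where "B = {j \<in> {1..K}. \<sigma> j \<in> A}"
    have "A \<subseteq> \<sigma> ` {1..K}" using A permutes_image[OF \<sigma>] by simp
    then have "\<sigma> ` B = A" unfolding B_def by blast
    then have "card B = card A"
      using card_image[OF permutes_inj_on[OF \<sigma>], of B] by simp
    also have "card A = K - (l - 1)" using l by (auto simp: A_def)
    finally have "(\<Sum>j=(l-1)+1..K. \<alpha> j) \<le> sum \<alpha> B"
      using weights_antimono[OF \<alpha>] by (intro sum_tail_le_sum_subset) (auto simp: B_def)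
    then have "(\<alpha> l + (\<Sum>j=l+1..K. \<alpha> j)) * a \<le> sum \<alpha> B * a"
      using l a by (intro mult_right_mono) (auto simp: sum.atLeast_Suc_atMost)
    also have "\<dots> = (\<Sum>j=1..K. if \<sigma> j \<in> A then \<alpha> j * a else 0)"
      by (simp add: sum.If_cases B_def sum_distrib_right Int_def)
    also have "\<dots> = s"
      unfolding s using permutes_in_image[OF \<sigma>] by (intro sum.cong) (auto simp: JA)
    finally show "(\<alpha> l + (\<Sum>j=l+1..K. \<alpha> j)) * a \<le> s" .
  qed
  then show ?thesis unfolding bracket_def main coef_def by (simp add: algebra_simps)
qed

section \<open>Optimal weights\<close>

lemma min_coef_attained:
  assumes "1 \<le> K"
  obtains l where "l \<in> {1..K}" "min_coef K \<alpha> = coef K \<alpha> l"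
proof -
  have "min_coef K \<alpha> \<in> coef K \<alpha> ` {1..K}"
    unfolding min_coef_def using assms by (intro Min_in) auto
  with that show ?thesis by auto
qed

text \<open>If every coefficient exceeded \<open>2 - \<epsilon>\<close>, each weight would be less
  than \<open>\<epsilon>\<close> plus the tail after it. Prepending a weight would then at most
  double the tail and add \<open>\<epsilon>\<close>; starting from the empty tail this forces
  \<open>\<alpha> 1 < 2 ^ (K - 1) * \<epsilon> = 1\<close>.\<close>

lemma min_coef_le:
  assumes \<alpha>: "\<alpha> \<in> weights K" and K: "1 \<le> K"
  shows "min_coef K \<alpha> \<le> 2 - (1 / 2) ^ (K - 1)"
proof (rule ccontr)
  define \<epsilon> :: real where "\<epsilon> = (1 / 2) ^ (K - 1)"
  assume gt: "\<not> ?thesis"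
  have *: "\<alpha> l < \<epsilon> + (\<Sum>j=l+1..K. \<alpha> j)" if "l \<in> {1..K}" for l
  proof -
    have "min_coef K \<alpha> \<le> coef K \<alpha> l" unfolding min_coef_def using that by (intro Min_le) auto
    with gt show ?thesis by (simp add: coef_def \<epsilon>_def)
  qed
  have tail: "(\<Sum>j=l+1..K. \<alpha> j) \<le> (2 ^ (K - l) - 1) * \<epsilon>" if "1 \<le> l" "l \<le> K" for l
    using that(2,1)
  proof (induction l rule: inc_induct)
    case (step l)
    have "(\<Sum>j=l+1..K. \<alpha> j) = \<alpha> (Suc l) + (\<Sum>j=Suc l+1..K. \<alpha> j)"
      using step by (simp add: sum.atLeast_Suc_atMost)
    also have "\<dots> \<le> \<epsilon> + 2 * ((2 ^ (K - Suc l) - 1) * \<epsilon>)"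
      using *[of "Suc l"] step by simp
    also have "\<dots> = (2 * 2 ^ (K - Suc l) - 1) * \<epsilon>" by (simp add: algebra_simps)
    also have "2 * 2 ^ (K - Suc l) = (2::real) ^ (K - l)"
      using step by (metis Suc_diff_Suc power_Suc)
    finally show ?case .
  qed simp
  have "\<alpha> 1 < 2 ^ (K - 1) * \<epsilon>" using *[of 1] tail[of 1] K by (simp add: algebra_simps)
  also have "\<dots> = 1" by (simp add: \<epsilon>_def power_one_over)
  finally show False using \<alpha> by (simp add: weights_def)
qed

lemma geometric_weights:
  "(\<lambda>j. (1 / 2) ^ (j - 1)) \<in> weights K"
  by (auto simp: weights_def intro!: power_decreasing)

text \<open>The tail beyond \<open>l\<close> telescopes to the weight at \<open>l\<close> minus the
  weight at \<open>K\<close>, so \<open>l\<close> cancels from \<open>coef\<close>.\<close>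

lemma min_coef_geometric:
  assumes K: "1 \<le> K"
  shows "min_coef K (\<lambda>j. (1 / 2) ^ (j - 1)) = 2 - (1 / 2) ^ (K - 1)"
proof -
  have "(\<Sum>j=l+1..K. (1 / 2 :: real) ^ (j - 1)) = (1 / 2) ^ (l - 1) - (1 / 2) ^ (K - 1)"
    if "1 \<le> l" "l \<le> K" for l
    using that(2,1)
  proof (induction l rule: inc_induct)
    case (step l)
    have "(1 / 2 :: real) ^ (l - 1) = 2 * (1 / 2) ^ l" using step by (cases l) auto
    with step show ?case by (simp add: sum.atLeast_Suc_atMost)
  qed simp
  then have "coef K (\<lambda>j. (1 / 2) ^ (j - 1)) l = 2 - (1 / 2) ^ (K - 1)" if "l \<in> {1..K}" for l
    using that by (simp add: coef_def)
  with min_coef_attained[OF K] show ?thesis by metis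
qed

section \<open>Infima over the space\<close>

text \<open>The sublevel set at 1 is nonempty and compact, and \<open>I\<close> is finite, hence
  continuous, on it. A minimiser there is a global one.\<close>

lemma rate_function_attains_zero:
  fixes I :: "'a::topological_space \<Rightarrow> ennreal"
  assumes "rate_function I" "(INF x. I x) = 0" "continuous_on {x. I x < \<infinity>} I"
  obtains z where "I z = 0"
proof -
  let ?C = "{x. I x \<le> 1}"
  have "\<exists>x. I x < 1" using assms(2) by (metis INF_less_iff zero_less_one)
  then have ne: "?C \<noteq> {}" using order.strict_implies_order by blast
  have "compact ?C" using assms(1) by (simp add: rate_function_def)
  moreover have "continuous_on ?C I"
    using assms(3) by (rule continuous_on_subset) (auto intro: order.strict_trans1)
  ultimately obtain z where z: "z \<in> ?C" "\<And>y. y \<in> ?C \<Longrightarrow> I z \<le> I y"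
    using ne continuous_attains_inf[of ?C I] by blast
  have "I z \<le> I y" for y
    using z by (cases "I y \<le> 1") (auto intro: order.trans)
  then have "I z \<le> (INF x. I x)" by (intro INF_greatest) auto
  with that assms(2) show ?thesis by simp
qed

text \<open>For a fixed point of \<open>D_set\<close>, the two bounds on the bracket meet at an
  \<open>l\<close> minimising \<open>coef\<close>. The weights then enter only through
  \<open>min_coef\<close>.\<close>

lemma V_eq_INF_min_coef:
  assumes \<alpha>: "\<alpha> \<in> weights K" and K: "1 \<le> K"
  shows "V I F K \<alpha> = (INF x\<in>{x. I x < \<infinity>}. ereal (min_coef K \<alpha> * enn2real (I x) + 2 * F x))"
proof (rule antisym)
  obtain l where l: "l \<in> {1..K}" "min_coef K \<alpha> = coef K \<alpha> l" using min_coef_attained[OF K] by blast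
  show "V I F K \<alpha> \<le> (INF x\<in>{x. I x < \<infinity>}. ereal (min_coef K \<alpha> * enn2real (I x) + 2 * F x))"
  proof (rule INF_greatest)
    fix x assume "x \<in> {x. I x < \<infinity>}"
    then have D: "(enn2real (I x), F x) \<in> D_set I F" by (auto simp: D_set_def)
    define J where "J j = (if j = 1 \<or> l < j then enn2real (I x) else 0)" for j
    have "V I F K \<alpha> \<le> ereal (bracket K \<alpha> J (F x))"
      unfolding V_def using D by (intro Inf_lower CollectI exI[of _ J] exI[of _ "F x"]) (auto simp: J_def)
    also have "\<dots> \<le> ereal (coef K \<alpha> l * enn2real (I x) + 2 * F x)"
      using bracket_extremal_le[OF \<alpha> l(1), of "enn2real (I x)" J] by (simp add: J_def)
    finally show "V I F K \<alpha> \<le> ereal (min_coef K \<alpha> * enn2real (I x) + 2 * F x)" using l by simp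
  qed
  show "(INF x\<in>{x. I x < \<infinity>}. ereal (min_coef K \<alpha> * enn2real (I x) + 2 * F x)) \<le> V I F K \<alpha>"
    unfolding V_def
  proof (rule Inf_greatest)
    fix v assume "v \<in> {ereal (bracket K \<alpha> J f) | J f.
      (J 1, f) \<in> D_set I F \<and> (\<forall>j\<in>{2..K}. J j \<in> {0..J 1})}"
    then obtain J f where v: "v = ereal (bracket K \<alpha> J f)" and D: "(J 1, f) \<in> D_set I F"
      and J: "\<And>j. j \<in> {2..K} \<Longrightarrow> J j \<in> {0..J 1}" by blast
    from D obtain x where x: "I x < \<infinity>" "J 1 = enn2real (I x)" "f = F x" by (auto simp: D_set_def)
    have "0 \<le> J j" if "j \<in> {1..K}" for j
      using J[of j] x(2) that by (cases "j = 1") auto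
    then have "min_coef K \<alpha> * J 1 + 2 * f \<le> bracket K \<alpha> J f"
      by (rule bracket_ge_min_coef[OF \<alpha> _ K])
    then show "(INF x\<in>{x. I x < \<infinity>}. ereal (min_coef K \<alpha> * enn2real (I x) + 2 * F x)) \<le> v"
      using x by (intro INF_lower2[of x]) (auto simp: v)
  qed
qed

lemma INF_bracket_at_eq_V:
  assumes \<alpha>: "\<alpha> \<in> weights K" and K: "1 \<le> K" and z: "I z = 0"
  shows "(INF x. bracket_at I F K \<alpha> x) = V I F K \<alpha>"
  unfolding V_eq_INF_min_coef[OF \<alpha> K]
proof (rule antisym)
  obtain l where l: "l \<in> {1..K}" "min_coef K \<alpha> = coef K \<alpha> l" using min_coef_attained[OF K] by blast
  show "(INF x. bracket_at I F K \<alpha> x)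
      \<le> (INF x\<in>{x. I x < \<infinity>}. ereal (min_coef K \<alpha> * enn2real (I x) + 2 * F x))"
  proof (rule INF_greatest)
    fix x assume x: "x \<in> {x. I x < \<infinity>}"
    \<comment> \<open>Copies of \<open>x\<close> and of the zero \<open>z\<close> of the rate
      realise the extremal rates exactly, with no need for intermediate values of
      \<open>I\<close>.\<close>
    define y where "y j = (if j = 1 \<or> l < j then x else z)" for j :: nat
    have "(INF x. bracket_at I F K \<alpha> x) \<le> bracket_at I F K \<alpha> y" by (rule INF_lower) simp
    also have "\<dots> = ereal (bracket K \<alpha> (\<lambda>j. enn2real (I (y j))) (F x))"
      using x z by (auto simp: bracket_at_def y_def)
    also have "\<dots> \<le> ereal (coef K \<alpha> l * enn2real (I x) + 2 * F x)"
      using bracket_extremal_le[OF \<alpha> l(1), of "enn2real (I x)" "\<lambda>j. enn2real (I (y j))"] z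
      by (simp add: y_def)
    finally show "(INF x. bracket_at I F K \<alpha> x) \<le> ereal (min_coef K \<alpha> * enn2real (I x) + 2 * F x)"
      using l by simp
  qed
  show "(INF x\<in>{x. I x < \<infinity>}. ereal (min_coef K \<alpha> * enn2real (I x) + 2 * F x))
      \<le> (INF x. bracket_at I F K \<alpha> x)"
  proof (rule INF_greatest)
    fix x
    show "(INF x\<in>{x. I x < \<infinity>}. ereal (min_coef K \<alpha> * enn2real (I x) + 2 * F x))
        \<le> bracket_at I F K \<alpha> x"
    proof (cases "\<exists>j\<in>{1..K}. I (x j) = \<infinity>")
      case False
      then have "I (x 1) < \<infinity>" using K by (auto simp: top.not_eq_extremum)
      moreover have "min_coef K \<alpha> * enn2real (I (x 1)) + 2 * F (x 1)
          \<le> bracket K \<alpha> (\<lambda>j. enn2real (I (x j))) (F (x 1))"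
        using bracket_ge_min_coef[OF \<alpha> _ K, of "\<lambda>j. enn2real (I (x j))"] by simp
      ultimately show ?thesis
        using False by (intro INF_lower2[of "x 1"]) (auto simp: bracket_at_def)
    qed (simp add: bracket_at_def)
  qed
qed

text \<open>Points of infinite rate contribute \<open>\<infinity>\<close> to the right side.
  Positivity of \<open>c\<close> matters here, because \<open>0 * \<infinity> = 0\<close> in
  \<open>ereal\<close>.\<close>

lemma INF_finite_rate:
  assumes "0 < c"
  shows "(INF x\<in>{x. I x < \<infinity>}. ereal (c * enn2real (I x) + 2 * F x))
    = (INF x. ereal c * enn2ereal (I x) + ereal (2 * F x))"
proof -
  have fin: "ereal c * enn2ereal (I x) + ereal (2 * F x) = ereal (c * enn2real (I x) + 2 * F x)"
    if "I x < \<infinity>" for x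
    using that by (cases "I x") auto
  have inf: "ereal c * enn2ereal (I x) + ereal (2 * F x) = \<infinity>" if "\<not> I x < \<infinity>" for x
    using that assms by (simp add: top.not_eq_extremum[symmetric])
  show ?thesis
  proof (rule antisym)
    show "(INF x\<in>{x. I x < \<infinity>}. ereal (c * enn2real (I x) + 2 * F x))
        \<le> (INF x. ereal c * enn2ereal (I x) + ereal (2 * F x))"
    proof (rule INF_greatest)
      fix x
      show "(INF x\<in>{x. I x < \<infinity>}. ereal (c * enn2real (I x) + 2 * F x))
          \<le> ereal c * enn2ereal (I x) + ereal (2 * F x)"
        by (cases "I x < \<infinity>") (auto simp del: infinity_ennreal_def simp: fin inf intro!: INF_lower)
    qed
    show "(INF x. ereal c * enn2ereal (I x) + ereal (2 * F x))
        \<le> (INF x\<in>{x. I x < \<infinity>}. ereal (c * enn2real (I x) + 2 * F x))"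
      by (rule INF_greatest) (auto simp flip: fin intro: INF_lower)
  qed
qed

theorem lemma3p1:
  fixes I :: "'a::polish_space \<Rightarrow> ennreal" and F :: "'a \<Rightarrow> real" and K :: nat
  assumes "rate_function I"
    and "(INF x. I x) = 0"
    and "continuous_on {x. I x < \<infinity>} I"
    and "continuous_on UNIV F"
    and "bdd_below (range F)"
    and "1 \<le> K"
  defines "\<alpha>s \<equiv> \<lambda>j. (1 / 2) ^ (j - 1)"
  shows "(\<forall>\<alpha>\<in>weights K. (INF x. bracket_at I F K \<alpha> x) = V I F K \<alpha>)
    \<and> (SUP \<alpha>\<in>weights K. V I F K \<alpha>)
        = (INF x. ereal (2 - (1 / 2) ^ (K - 1)) * enn2ereal (I x) + ereal (2 * F x))
    \<and> \<alpha>s \<in> weights K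
    \<and> V I F K \<alpha>s = (SUP \<alpha>\<in>weights K. V I F K \<alpha>)"
proof (intro conjI ballI)
  show "(INF x. bracket_at I F K \<alpha> x) = V I F K \<alpha>" if "\<alpha> \<in> weights K" for \<alpha>
    using rate_function_attains_zero[OF assms(1-3)] INF_bracket_at_eq_V[OF that assms(6)] by metis
  show mem: "\<alpha>s \<in> weights K" unfolding \<alpha>s_def by (rule geometric_weights)
  have star: "min_coef K \<alpha>s = 2 - (1 / 2) ^ (K - 1)"
    unfolding \<alpha>s_def by (rule min_coef_geometric[OF assms(6)])
  \<comment> \<open>Rates are nonnegative, so \<open>V\<close> is monotone in
    \<open>min_coef\<close>, and weights maximising \<open>min_coef\<close> maximise
    \<open>V\<close>.\<close>
  have "V I F K \<alpha> \<le> V I F K \<alpha>s" if "\<alpha> \<in> weights K" for \<alpha>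
    unfolding V_eq_INF_min_coef[OF that assms(6)] V_eq_INF_min_coef[OF mem assms(6)] star
    using min_coef_le[OF that assms(6)] by (intro INF_mono') (auto intro!: mult_right_mono)
  then show max: "V I F K \<alpha>s = (SUP \<alpha>\<in>weights K. V I F K \<alpha>)"
    using mem by (intro antisym SUP_upper SUP_least)
  have "(1 / 2 :: real) ^ (K - 1) \<le> 1" by (simp add: power_le_one)
  then have "0 < 2 - (1 / 2 :: real) ^ (K - 1)" by linarith
  then show "(SUP \<alpha>\<in>weights K. V I F K \<alpha>)
      = (INF x. ereal (2 - (1 / 2) ^ (K - 1)) * enn2ereal (I x) + ereal (2 * F x))"
    unfolding max[symmetric] V_eq_INF_min_coef[OF mem assms(6)] star by (rule INF_finite_rate)
qed

end
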